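(* Let $G$ be an abelian group of order $v$ and let $m\ge 3$. Then there does not exist a classical $(v,m,k,\lambda)$-PSEDF in $G$.
   Context: For subsets $A,B$ of an additively written group $G$, $\Delta(A,B)$ denotes the multiset $\{a-b: a\in A, b\in B\}$ (one entry for each pair). For a set $S$ and $\lambda\in\mathbb{N}$, $\lambda S$ denotes the multiset consisting of $\lambda$ copies of $S$. A classical $(v,m,k,\lambda)$-PSEDF in a group $G$ of order $v$ is a family of $m$ pairwise disjoint $k$-subsets $\{A_1,\dots,A_m\}$ of $G$ such that for every $1\le i\ne j\le m$ the multiset equation $\Delta(A_i,A_j)=\lambda(G\setminus\{0\})$ holds. *)

theory Defs
  imports "HOL-Algebra.Group" "HOL-Algebra.Coset" "HOL-Library.Multiset"
begin

(* Groups are multiplicative records in HOL-Algebra: a - b is rendered as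
   a \<otimes> inv b, and 0 as \<one>. *)

definition diff_mset ::
  "('a, 'b) monoid_scheme \<Rightarrow> 'a set \<Rightarrow> 'a set \<Rightarrow> 'a multiset" where
  "diff_mset G A B =
     image_mset (\<lambda>(a, b). a \<otimes>\<^bsub>G\<^esub> inv\<^bsub>G\<^esub> b) (mset_set (A \<times> B))"

(* The family {A_1, ..., A_m} is a set of m (hence distinct) subsets. In particular k = 0
   is possible only for m \<le> 1; an indexed family that may repeat the empty set
   would satisfy all conditions with k = 0 and lam = 0 for every m. *)
definition classical_PSEDF ::
  "('a, 'b) monoid_scheme \<Rightarrow> nat \<Rightarrow> nat \<Rightarrow> nat \<Rightarrow> nat \<Rightarrow> 'a set set \<Rightarrow> bool" where
  "classical_PSEDF G v m k lam \<A> \<longleftrightarrow>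
     group G \<and> finite (carrier G) \<and> order G = v \<and>
     finite \<A> \<and> card \<A> = m \<and>
     (\<forall>A\<in>\<A>. A \<subseteq> carrier G \<and> card A = k) \<and>
     pairwise disjnt \<A> \<and>
     (\<forall>A\<in>\<A>. \<forall>B\<in>\<A>. A \<noteq> B \<longrightarrow>
        diff_mset G A B = repeat_mset lam (mset_set (carrier G - {\<one>\<^bsub>G\<^esub>})))"

end

theory Submission
  imports Defs
begin

text \<open>
  For distinct members \<open>A\<close>, \<open>B\<close>, \<open>C\<close> of the family, count the quadruples
  \<open>(a, b, c, b')\<close> in \<open>A \<times> B \<times> C \<times> B\<close> with \<open>a - b = c - b'\<close>. Using the differences
  \<open>\<Delta>(A, B)\<close> and \<open>\<Delta>(C, B)\<close> gives \<open>\<lambda>\<^sup>2 (v - 1) = \<lambda> k\<^sup>2\<close>. Commutativity turns the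
  equation into \<open>a - c = b - b'\<close>; since every non-zero element occurs \<open>\<lambda>\<close> times in
  \<open>\<Delta>(A, C)\<close> and \<open>0\<close> does not occur, the same number is \<open>\<lambda> (k\<^sup>2 - k)\<close>. As
  \<open>k\<^sup>2 = \<lambda> (v - 1)\<close>, this forces \<open>k = 0\<close>.
\<close>

lemma sum_mset_repeat_mset:
  fixes f :: "'a \<Rightarrow> nat"
  shows "(\<Sum>x\<in>#repeat_mset n M. f x) = n * (\<Sum>x\<in>#M. f x)"
  by (induction n) auto

text \<open>Turns a multiset equation into one between sums: constant \<open>f\<close> counts pairs,
  an indicator \<open>f\<close> reads off a multiplicity.\<close>

lemma sum_diff_mset:
  fixes f :: "'a \<Rightarrow> nat"
  assumes "diff_mset G A B = repeat_mset lam (mset_set D)"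
  shows "(\<Sum>a\<in>A. \<Sum>b\<in>B. f (a \<otimes>\<^bsub>G\<^esub> inv\<^bsub>G\<^esub> b)) = lam * (\<Sum>g\<in>D. f g)"
proof -
  have "(\<Sum>x\<in>#diff_mset G A B. f x) = (\<Sum>a\<in>A. \<Sum>b\<in>B. f (a \<otimes>\<^bsub>G\<^esub> inv\<^bsub>G\<^esub> b))"
    by (simp add: diff_mset_def image_mset.compositionality comp_def case_prod_unfold
        sum_unfold_sum_mset [symmetric] sum.cartesian_product)
  then show ?thesis
    by (simp add: assms sum_mset_repeat_mset sum_unfold_sum_mset [symmetric])
qed

text \<open>Commutativity enters here: cross-multiplying gives
  \<open>a \<otimes> d = c \<otimes> b\<close> on the left and
  \<open>a \<otimes> d = b \<otimes> c\<close> on the right.\<close>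

lemma (in comm_group) div_eq_div_swap:
  assumes "a \<in> carrier G" "b \<in> carrier G" "c \<in> carrier G" "d \<in> carrier G"
  shows "a \<otimes> inv b = c \<otimes> inv d \<longleftrightarrow> a \<otimes> inv c = b \<otimes> inv d"
proof -
  have "a \<otimes> inv b = c \<otimes> inv d \<longleftrightarrow> a \<otimes> d = c \<otimes> b"
    if "a \<in> carrier G" "b \<in> carrier G" "c \<in> carrier G" "d \<in> carrier G" for a b c d
  proof -
    have "a \<otimes> inv b = c \<otimes> inv d \<longleftrightarrow> a = c \<otimes> inv d \<otimes> b"
      using that by (simp add: inv_solve_right')
    also have "c \<otimes> inv d \<otimes> b = c \<otimes> b \<otimes> inv d"
      using that by (simp add: m_ac)
    also have "a = c \<otimes> b \<otimes> inv d \<longleftrightarrow> a \<otimes> d = c \<otimes> b"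
      using that by (auto simp: inv_solve_right)
    finally show ?thesis .
  qed
  from this [of a b c d] this [of a c b d] show ?thesis
    using assms by (simp add: m_comm)
qed

lemma (in comm_group) no_three_external_differences:
  assumes fin: "finite (carrier G)"
    and sub: "A \<subseteq> carrier G" "B \<subseteq> carrier G" "C \<subseteq> carrier G"
    and card: "card A = k" "card B = k"
    and AB: "diff_mset G A B = repeat_mset lam (mset_set (carrier G - {\<one>}))"
    and CB: "diff_mset G C B = repeat_mset lam (mset_set (carrier G - {\<one>}))"
    and AC: "diff_mset G A C = repeat_mset lam (mset_set (carrier G - {\<one>}))"
  shows "k = 0"
proof (rule ccontr)
  assume "k \<noteq> 0"
  let ?D = "carrier G - {\<one>}"
  let ?I = "\<lambda>x y. if x = y then 1 else 0 :: nat"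
  have finB: "finite B"
    using fin sub finite_subset by blast
  have k2: "k * k = lam * card ?D"
    using sum_diff_mset [OF AB, of "\<lambda>_. 1"] card by simp
  \<comment> \<open>The number of representations of \<open>g\<close> as a difference; it is 0 at
    \<open>g = \<one>\<close>.\<close>
  have count: "(\<Sum>x\<in>X. \<Sum>y\<in>Y. ?I g (x \<otimes> inv y)) = lam * (if g \<in> ?D then 1 else 0)"
    if "diff_mset G X Y = repeat_mset lam (mset_set ?D)" for X Y g
    using sum_diff_mset [OF that, of "?I g"] fin by simp
  have "(\<Sum>a\<in>A. \<Sum>b\<in>B. \<Sum>c\<in>C. \<Sum>d\<in>B. ?I (a \<otimes> inv b) (c \<otimes> inv d))
      = (\<Sum>a\<in>A. \<Sum>b\<in>B. lam * (if a \<otimes> inv b \<in> ?D then 1 else 0))"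
    by (simp only: count [OF CB])
  \<comment> \<open>The summand depends only on \<open>a \<otimes> inv b\<close>, so the sum moves
    to \<open>?D\<close>, where the condition always holds.\<close>
  also have "\<dots> = lam * (\<Sum>g\<in>?D. lam * (if g \<in> ?D then 1 else 0))"
    by (rule sum_diff_mset [OF AB, of "\<lambda>g. lam * (if g \<in> ?D then 1 else 0)"])
  also have "\<dots> = lam * (k * k)"
    by (simp add: k2)
  finally have "lam * (k * k)
      = (\<Sum>a\<in>A. \<Sum>b\<in>B. \<Sum>c\<in>C. \<Sum>d\<in>B. ?I (a \<otimes> inv b) (c \<otimes> inv d))" ..
  also have "\<dots> = (\<Sum>a\<in>A. \<Sum>b\<in>B. \<Sum>c\<in>C. \<Sum>d\<in>B. ?I (b \<otimes> inv d) (a \<otimes> inv c))"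
  proof (intro sum.cong refl)
    fix a b c d assume "a \<in> A" "b \<in> B" "c \<in> C" "d \<in> B"
    then have "a \<otimes> inv b = c \<otimes> inv d \<longleftrightarrow> b \<otimes> inv d = a \<otimes> inv c"
      using div_eq_div_swap [of a b c d] sub by (metis subsetD)
    then show "?I (a \<otimes> inv b) (c \<otimes> inv d) = ?I (b \<otimes> inv d) (a \<otimes> inv c)"
      by simp
  qed
  \<comment> \<open>Three swaps bring \<open>a\<close> and \<open>c\<close> innermost, so that
    \<open>count\<close> applies with \<open>g = b \<otimes> inv d\<close>.\<close>
  also have "\<dots> = (\<Sum>a\<in>A. \<Sum>b\<in>B. \<Sum>d\<in>B. \<Sum>c\<in>C. ?I (b \<otimes> inv d) (a \<otimes> inv c))"
    by (rule sum.cong [OF refl], rule sum.cong [OF refl], rule sum.swap)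
  also have "\<dots> = (\<Sum>b\<in>B. \<Sum>a\<in>A. \<Sum>d\<in>B. \<Sum>c\<in>C. ?I (b \<otimes> inv d) (a \<otimes> inv c))"
    by (rule sum.swap)
  also have "\<dots> = (\<Sum>b\<in>B. \<Sum>d\<in>B. \<Sum>a\<in>A. \<Sum>c\<in>C. ?I (b \<otimes> inv d) (a \<otimes> inv c))"
    by (rule sum.cong [OF refl], rule sum.swap)
  also have "\<dots> = (\<Sum>b\<in>B. \<Sum>d\<in>B. lam * (if b \<otimes> inv d \<in> ?D then 1 else 0))"
    by (simp only: count [OF AC])
  \<comment> \<open>The diagonal \<open>d = b\<close> gives difference \<open>\<one>\<close> and
    drops out; this loss separates the two counts.\<close>
  also have "\<dots> = (\<Sum>b\<in>B. \<Sum>d\<in>B. if d = b then 0 else lam)"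
  proof (intro sum.cong refl)
    fix b d assume "b \<in> B" "d \<in> B"
    then have "b \<in> carrier G" "d \<in> carrier G"
      using sub by auto
    then show "lam * (if b \<otimes> inv d \<in> ?D then 1 else 0) = (if d = b then 0 else lam)"
      by (auto simp: inv_solve_right')
  qed
  also have "\<dots> = (\<Sum>b\<in>B. (k - 1) * lam)"
  proof (rule sum.cong [OF refl])
    fix b assume "b \<in> B"
    then have "(\<Sum>d\<in>B. if d = b then 0 else lam) = (\<Sum>d\<in>B - {b}. lam)"
      using finB by (subst sum.remove [of B b]) (auto intro: sum.cong)
    then show "(\<Sum>d\<in>B. if d = b then 0 else lam) = (k - 1) * lam"
      using \<open>b \<in> B\<close> card finB by simp
  qed
  also have "\<dots> = lam * (k * (k - 1))"
    using card by simp
  \<comment> \<open>The counts differ by \<open>lam * k\<close>; as \<open>k\<close> is a successor,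
    \<open>k - 1\<close> is not truncated.\<close>
  finally have "lam = 0"
    using \<open>k \<noteq> 0\<close> by (cases k) (simp_all add: distrib_left)
  with k2 \<open>k \<noteq> 0\<close> show False
    by simp
qed

theorem theorem2p22:
  fixes G :: "('a, 'b) monoid_scheme" and v m k lam :: nat
  assumes "comm_group G" and "finite (carrier G)" and "order G = v"
    and "m \<ge> 3"
  shows "\<not> (\<exists>\<A>. classical_PSEDF G v m k lam \<A>)"
proof
  assume "\<exists>\<A>. classical_PSEDF G v m k lam \<A>"
  then obtain \<A> where PSEDF: "classical_PSEDF G v m k lam \<A>"
    by (rule exE)
  have mem: "A \<subseteq> carrier G" "card A = k" if "A \<in> \<A>" for A
    using PSEDF that by (simp_all add: classical_PSEDF_def)
  have diff: "diff_mset G A B = repeat_mset lam (mset_set (carrier G - {\<one>\<^bsub>G\<^esub>}))"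
    if "A \<in> \<A>" "B \<in> \<A>" "A \<noteq> B" for A B
    using PSEDF that by (simp add: classical_PSEDF_def)
  have "3 \<le> card \<A>"
    using PSEDF \<open>m \<ge> 3\<close> by (simp add: classical_PSEDF_def)
  then obtain \<B> where "\<B> \<subseteq> \<A>" "card \<B> = 3"
    by (rule obtain_subset_with_card_n)
  moreover from \<open>card \<B> = 3\<close> obtain A B C
    where "\<B> = {A, B, C}" "A \<noteq> B" "B \<noteq> C" "A \<noteq> C"
    unfolding card_3_iff by blast
  ultimately have ABC: "A \<in> \<A>" "B \<in> \<A>" "C \<in> \<A>" "A \<noteq> B" "A \<noteq> C" "C \<noteq> B"
    by auto
  interpret comm_group G by fact
  have "k = 0"
    by (rule no_three_external_differences [of A B C k lam])
      (simp_all add: mem diff ABC assms(2))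
  \<comment> \<open>Finiteness is needed because infinite sets also have \<open>card\<close> 0.
    Distinct members cannot all be empty.\<close>
  then have "X = {}" if "X \<in> \<A>" for X
    using mem [OF that] finite_subset [OF _ assms(2)] by simp
  with ABC have "A = B"
    by blast
  with \<open>A \<noteq> B\<close> show False by simp
qed

end
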